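(* Suppose the prior $\Pi$ has the Kullback–Leibler property, i.e. $\Pi(\{f : D(f,f_0)<\varepsilon\})>0$ for every $\varepsilon>0$. Then for every (measurable) set of densities $A\subseteq\Omega$ for which $$\liminf_{n\to\infty} H(f_{nA},f_0)>0 \qquad \text{a.s. } [F_0^\infty],$$ one has $$\Pi^n(A)\to 0 \qquad \text{a.s. } [F_0^\infty] \text{ as } n\to\infty .$$
   Context: Let $X_1,X_2,\ldots$, taking values in $(\mathscr{X},\mathscr{B})$, be i.i.d. with fixed density $f_0$ (with respect to Lebesgue measure) and distribution $F_0$; $F_0^\infty$ is the infinite product measure, and all almost sure statements refer to it. $\Omega$ is the space of density functions (with respect to Lebesgue measure) on $(\mathscr{X},\mathscr{B})$, and the prior $\Pi$ is a probability distribution on $\Omega$. Put $R_n(f)=\prod_{i=1}^n f(X_i)/f_0(X_i)$ (with $R_0\equiv 1$). The posterior is $$\Pi^n(A)=\frac{\int_A R_n(f)\,\Pi(df)}{\int R_n(f)\,\Pi(df)} .$$ For a set of densities $A$, write $L_n=\int_A R_n(f)\,\Pi(df)$, so $L_0=\Pi(A)$; the predictive density with posterior restricted and normalized to $A$ is $$f_{nA}(x)=\int f(x)\,\Pi_A^n(df)=\frac{\int_A f(x)R_n(f)\,\Pi(df)}{L_n}.$$ It is understood that $A$ is such that this is well defined, i.e. $L_n>0$ a.s. for all $n\ge 0$. The Kullback–Leibler divergence is $D(f,f_0)=\int f_0\log(f_0/f)$ and the Hellinger distance is $H(f,f_0)=\{\int(\sqrt f-\sqrt{f_0})^2\}^{1/2}$.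 *)

theory Defs
  imports "HOL-Probability.Probability"
begin

(* Throughout, M is the dominating measure on the sample space and f0 the true density.
   Only the values of a density on space M matter. *)
definition densities :: "'a measure \<Rightarrow> ('a \<Rightarrow> real) set" where
  "densities M = {f. (\<forall>x\<in>space M. 0 \<le> f x) \<and> integrable M f \<and> (LINT x|M. f x) = 1}"

(* A prior lives on a set of densities with some sigma-algebra.  Joint measurability of
   evaluation is what makes integrals such as \<integral> f(x) R_n(f) \<Pi>(df) and Fubini's theorem
   meaningful.  The space is only required to be a subset of the set of all densities: no
   sigma-algebra on the set of all Borel densities makes evaluation jointly measurable
   (Aumann), so equality would be unsatisfiable on an interval, say. *)
definition is_prior :: "'a measure \<Rightarrow> ('a \<Rightarrow> real) measure \<Rightarrow> bool" where
  "is_prior M P \<longleftrightarrow> prob_space P \<and> space P \<subseteq> densities M \<and>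
     (\<lambda>(f, x). f x) \<in> borel_measurable (P \<Otimes>\<^sub>M M)"

definition seq_law :: "'a measure \<Rightarrow> ('a \<Rightarrow> real) \<Rightarrow> (nat \<Rightarrow> 'a) measure" where
  "seq_law M f0 = (\<Pi>\<^sub>M i\<in>UNIV. density M (\<lambda>x. ennreal (f0 x)))"

(* f0 log (f0/f) with the conventions 0 log (0/f) = 0 and f0 log (f0/0) = \<infinity> for f0 > 0. *)
definition kl_integrand :: "('a \<Rightarrow> real) \<Rightarrow> ('a \<Rightarrow> real) \<Rightarrow> 'a \<Rightarrow> ereal" where
  "kl_integrand f f0 x =
     (if f0 x = 0 then 0 else if f x = 0 then \<infinity> else ereal (f0 x * ln (f0 x / f x)))"

(* D(f, f0), the integral of f0 log (f0/f), as positive part minus negative part (e2ennreal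
   sends negative values to 0).  For densities the negative part is finite, so the value is
   well defined in (-\<infinity>, \<infinity>].  KL_divergence from HOL-Probability is not used because it is
   real-valued and yields 0 when the integral diverges. *)
definition kl_div :: "'a measure \<Rightarrow> ('a \<Rightarrow> real) \<Rightarrow> ('a \<Rightarrow> real) \<Rightarrow> ereal" where
  "kl_div M f f0 =
     enn2ereal (\<integral>\<^sup>+x. e2ennreal (kl_integrand f f0 x) \<partial>M)
     - enn2ereal (\<integral>\<^sup>+x. e2ennreal (- kl_integrand f f0 x) \<partial>M)"

definition kl_property :: "'a measure \<Rightarrow> ('a \<Rightarrow> real) measure \<Rightarrow> ('a \<Rightarrow> real) \<Rightarrow> bool" where
  "kl_property M P f0 \<longleftrightarrow>
     (\<forall>\<epsilon>::real. \<epsilon> > 0 \<longrightarrow> measure P {f \<in> space P. kl_div M f f0 < ereal \<epsilon>} > 0)"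

definition hellinger :: "'a measure \<Rightarrow> ('a \<Rightarrow> real) \<Rightarrow> ('a \<Rightarrow> real) \<Rightarrow> real" where
  "hellinger M f g = sqrt (LINT x|M. (sqrt (f x) - sqrt (g x))\<^sup>2)"

(* R_n(f); the observations X_1, X_2, ... are \<omega> 0, \<omega> 1, ... *)
definition lik_ratio :: "('a \<Rightarrow> real) \<Rightarrow> nat \<Rightarrow> (nat \<Rightarrow> 'a) \<Rightarrow> ('a \<Rightarrow> real) \<Rightarrow> real" where
  "lik_ratio f0 n \<omega> f = (\<Prod>i<n. f (\<omega> i) / f0 (\<omega> i))"

(* L_n.  Its expectation under seq_law is at most 1, so the integrand is almost surely
   integrable and the real-valued integral is the intended one. *)
definition restr_lik ::
  "('a \<Rightarrow> real) measure \<Rightarrow> ('a \<Rightarrow> real) \<Rightarrow> ('a \<Rightarrow> real) set \<Rightarrow> nat \<Rightarrow> (nat \<Rightarrow> 'a) \<Rightarrow> real" where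
  "restr_lik P f0 A n \<omega> = (LINT f:A|P. lik_ratio f0 n \<omega> f)"

definition posterior ::
  "('a \<Rightarrow> real) measure \<Rightarrow> ('a \<Rightarrow> real) \<Rightarrow> nat \<Rightarrow> (nat \<Rightarrow> 'a) \<Rightarrow> ('a \<Rightarrow> real) set \<Rightarrow> real" where
  "posterior P f0 n \<omega> A = restr_lik P f0 A n \<omega> / (LINT f|P. lik_ratio f0 n \<omega> f)"

(* f_{nA}; almost surely the integral is finite for almost every x. *)
definition predictive ::
  "('a \<Rightarrow> real) measure \<Rightarrow> ('a \<Rightarrow> real) \<Rightarrow> ('a \<Rightarrow> real) set \<Rightarrow> nat \<Rightarrow> (nat \<Rightarrow> 'a) \<Rightarrow> 'a \<Rightarrow> real" where
  "predictive P f0 A n \<omega> x =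
     (LINT f:A|P. f x * lik_ratio f0 n \<omega> f) / restr_lik P f0 A n \<omega>"

end

theory Submission imports Defs begin

text \<open>
  The posterior mass of \<open>A\<close> is \<open>L n\<close> divided by the evidence, the integral of the likelihood ratio
  over the whole prior. The proof (Walker's) shows that the numerator decays exponentially,
  whereas the denominator decays slower than any exponential.

  Numerator. \<open>L (n + 1) / L n\<close> is the ratio of the predictive density \<open>f_{nA}\<close> to \<open>f0\<close> at the next
  observation (\<open>restr_lik_Suc\<close>). Given the past, the mean of the square root of this ratio is the
  Hellinger affinity \<open>1 - H(f_{nA}, f0)^2 / 2\<close> (\<open>nn_integral_sqrt_ratio\<close>). Hence \<open>sqrt (L n)\<close>, divided by
  the product of the affinities met so far (raised to \<open>1 / 2\<close> where they are smaller), is a nonnegative supermartingale of mean at most 1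
  (\<open>nn_integral_damped_root_le_1\<close>), and by a Borel-Cantelli argument it almost surely grows slower than
  any exponential (\<open>AE_damped_root_subexponential\<close>). If the Hellinger distance stays away from zero, then
  the affinities stay away from 1, their product decays exponentially (\<open>prod_damping_le\<close>), and so does
  \<open>L n\<close>.

  Denominator. For \<open>f\<close> with \<open>D(f, f0) < \<epsilon>\<close>, the sums of \<open>ln (f0 / f) - \<epsilon>\<close> over the data form a random walk
  with negative drift; such a walk is almost surely bounded above (\<open>AE_bounded_walk\<close>), which
  means that \<open>exp (\<epsilon> n)\<close> times the likelihood ratio of \<open>f\<close> stays away from zero. Fubini's theorem
  carries this over to the integral over the neighbourhood, which has positive prior mass
  (\<open>AE_evidence_lower_bound\<close>).
\<close>

section \<open>Random walks with negative drift\<close>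

text \<open>
  The maximum of the partial sums of \<open>Y (\<omega> 0)\<close>, \<open>Y (\<omega> 1)\<close>, \<open>\<dots>\<close> up to time \<open>n\<close>, the empty sum
  included. The recursion peels off the first observation, so that it relates the maximum to the
  maximum of the shifted sequence, which has the same law.
\<close>
fun run_max :: "('a \<Rightarrow> real) \<Rightarrow> nat \<Rightarrow> (nat \<Rightarrow> 'a) \<Rightarrow> real" where
  "run_max Y 0 \<omega> = 0"
| "run_max Y (Suc n) \<omega> = max 0 (Y (\<omega> 0) + run_max Y n (\<lambda>i. \<omega> (Suc i)))"

lemma run_max_nonneg: "0 \<le> run_max Y n \<omega>"
  by (cases n) auto

lemma run_max_mono: "run_max Y n \<omega> \<le> run_max Y (Suc n) \<omega>"
proof (induction n arbitrary: \<omega>)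
  case (Suc n)
  show ?case using Suc[of "\<lambda>i. \<omega> (Suc i)"] by simp
qed simp

lemma sum_le_run_max: "(\<Sum>i<n. Y (\<omega> i)) \<le> run_max Y n \<omega>"
proof (induction n arbitrary: \<omega>)
  case (Suc n)
  show ?case using Suc[of "\<lambda>i. \<omega> (Suc i)"]
    by (simp add: sum.lessThan_Suc_shift del: sum.lessThan_Suc)
qed simp

text \<open>
  The bounds range over the natural numbers so that the event is a countable combination of
  measurable ones.
\<close>
definition unbounded_walk :: "('a \<Rightarrow> real) \<Rightarrow> (nat \<Rightarrow> 'a) \<Rightarrow> bool" where
  "unbounded_walk Y \<omega> \<longleftrightarrow> (\<forall>C::nat. \<exists>n. real C < (\<Sum>i<n. Y (\<omega> i)))"

lemma unbounded_walk_iff: "unbounded_walk Y \<omega> \<longleftrightarrow> (\<forall>C::real. \<exists>n. C < (\<Sum>i<n. Y (\<omega> i)))"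
  unfolding unbounded_walk_def by (meson order_le_less_trans real_arch_simple)

text \<open>
  Prepending one observation shifts all partial sums by the same finite amount; hence the event
  does not depend on the first observation. This is what stands in for a zero-one law below.
\<close>
lemma unbounded_walk_case_nat:
  "unbounded_walk Y (case_nat s \<omega>) \<longleftrightarrow> unbounded_walk Y \<omega>"
proof -
  have shift: "(\<Sum>i<Suc n. Y (case_nat s \<omega> i)) = Y s + (\<Sum>i<n. Y (\<omega> i))" for n
    by (simp add: sum.lessThan_Suc_shift del: sum.lessThan_Suc)
  show ?thesis
  proof
    assume unb: "unbounded_walk Y (case_nat s \<omega>)"
    show "unbounded_walk Y \<omega>"
      unfolding unbounded_walk_iff
    proof
      fix C
      obtain n where n: "max 0 (Y s + C) < (\<Sum>i<n. Y (case_nat s \<omega> i))"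
        using unb unfolding unbounded_walk_iff by blast
      then obtain m where "n = Suc m" by (cases n) auto
      with n shift[of m] show "\<exists>n. C < (\<Sum>i<n. Y (\<omega> i))" by (intro exI[of _ m]) auto
    qed
  next
    assume unb: "unbounded_walk Y \<omega>"
    show "unbounded_walk Y (case_nat s \<omega>)"
      unfolding unbounded_walk_iff
    proof
      fix C
      obtain n where "C - Y s < (\<Sum>i<n. Y (\<omega> i))"
        using unb unfolding unbounded_walk_iff by blast
      with shift[of n] show "\<exists>n. C < (\<Sum>i<n. Y (case_nat s \<omega> i))" by (intro exI[of _ "Suc n"]) auto
    qed
  qed
qed

lemma run_max_at_top_if_unbounded:
  assumes "unbounded_walk Y \<omega>"
  shows "filterlim (\<lambda>n. run_max Y n \<omega>) at_top sequentially"
  unfolding filterlim_at_top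
proof
  fix C
  obtain N where "C < (\<Sum>i<N. Y (\<omega> i))"
    using assms unfolding unbounded_walk_iff by blast
  then have "C \<le> run_max Y n \<omega>" if "N \<le> n" for n
    using sum_le_run_max[of Y \<omega> N] lift_Suc_mono_le[of "\<lambda>n. run_max Y n \<omega>", OF run_max_mono that]
    by linarith
  then show "eventually (\<lambda>n. C \<le> run_max Y n \<omega>) sequentially"
    by (auto simp: eventually_sequentially)
qed

lemma distr_pair_snd:
  assumes "prob_space M" and N: "sigma_finite_measure N"
  shows "distr (M \<Otimes>\<^sub>M N) N snd = N"
proof (rule measure_eqI)
  interpret M: prob_space M by fact
  interpret N: sigma_finite_measure N by fact
  fix E assume "E \<in> sets (distr (M \<Otimes>\<^sub>M N) N snd)"
  then have E: "E \<in> sets N" by simp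
  then have "snd -` E \<inter> space (M \<Otimes>\<^sub>M N) = space M \<times> E"
    by (auto simp: space_pair_measure dest: sets.sets_into_space)
  with E show "emeasure (distr (M \<Otimes>\<^sub>M N) N snd) E = emeasure N E"
    by (simp add: emeasure_distr N.emeasure_pair_measure_Times M.emeasure_space_1)
qed simp

context sequence_space
begin

lemma measurable_shift [measurable]: "(\<lambda>\<omega> i. \<omega> (Suc i)) \<in> measurable S S"
  by (rule measurable_PiM_single') (auto simp: space_PiM PiE_iff)

lemma measurable_run_max [measurable]:
  assumes [measurable]: "Y \<in> borel_measurable M"
  shows "run_max Y n \<in> borel_measurable S"
proof (induction n)
  case (Suc n)
  note [measurable] = Suc
  show ?case by simp
qed simp

lemma integrable_run_max:
  assumes "integrable M Y"
  shows "integrable S (run_max Y n)"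
proof (induction n)
  case (Suc n)
  have [measurable]: "Y \<in> borel_measurable M" using assms by auto
  have "integrable (distr S M (\<lambda>\<omega>. \<omega> 0)) Y"
    using assms by (subst distr_PiM_component) (auto intro: prob_space_axioms M.prob_space_axioms)
  then have 1: "integrable S (\<lambda>\<omega>. Y (\<omega> 0))" by (subst (asm) integrable_distr_eq) auto
  have d: "distr S S (\<lambda>\<omega> i. \<omega> (Suc i)) = S"
  proof -
    have "distr S S (\<lambda>\<omega> i. \<omega> (Suc i))
        = distr (distr (M \<Otimes>\<^sub>M S) S (\<lambda>(s, \<omega>). case_nat s \<omega>)) S (\<lambda>\<omega> i. \<omega> (Suc i))"
      by (simp add: PiM_iter)
    also have "\<dots> = distr (M \<Otimes>\<^sub>M S) S snd"
      by (subst distr_distr) (auto intro!: distr_cong simp: comp_def)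
    also have "\<dots> = S"
      by (intro distr_pair_snd M.prob_space_axioms sigma_finite_measure_axioms)
    finally show ?thesis .
  qed
  from Suc have "integrable (distr S S (\<lambda>\<omega> i. \<omega> (Suc i))) (run_max Y n)" by (simp add: d)
  then have 2: "integrable S (\<lambda>\<omega>. run_max Y n (\<lambda>i. \<omega> (Suc i)))"
    by (subst (asm) integrable_distr_eq) auto
  show ?case using 1 2 by simp
qed simp

text \<open>
  This is the part of the strong law of large numbers that consistency needs; it follows from
  Garsia's proof of the maximal ergodic inequality. Let \<open>B\<close> be the event that the walk is unbounded
  and \<open>R n\<close> the running maximum. Writing a sequence as a first observation \<open>s\<close> followed by \<open>\<omega>\<close>,
  \<open>R (Suc n) = R n \<omega> + max (- R n \<omega>) (Y s)\<close>. Integrating over \<open>B\<close>, which is shift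
  invariant, gives \<open>E[1_B max (- R n) (Y s)] = E[1_B (R (Suc n) - R n)] \<ge> 0\<close>. On \<open>B\<close> the
  maxima grow to infinity, so the left side tends to \<open>E[1_B(\<omega>) Y s] = P(B) E[Y]\<close>. As \<open>E[Y] < 0\<close>, this
  forces \<open>P(B) = 0\<close>.
\<close>
lemma AE_bounded_walk:
  fixes Y :: "'a \<Rightarrow> real"
  assumes Y: "integrable M Y" and neg: "(\<integral>x. Y x \<partial>M) < 0"
  shows "AE \<omega> in S. \<exists>C. \<forall>n. (\<Sum>i<n. Y (\<omega> i)) \<le> C"
proof -
  interpret MS: pair_sigma_finite M S ..
  have [measurable]: "Y \<in> borel_measurable M" using Y by auto
  define B where "B = {\<omega> \<in> space S. unbounded_walk Y \<omega>}"
  have B [measurable]: "B \<in> sets S" unfolding B_def unbounded_walk_def by measurable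
  define a where "a n = (\<integral>\<omega>. indicator B \<omega> * run_max Y n \<omega> \<partial>S)" for n
  have int: "integrable S (\<lambda>\<omega>. indicator B \<omega> * run_max Y n \<omega>)" for n
    using integrable_mult_indicator[OF B integrable_run_max[OF Y, of n]] by simp
  have B_shift: "case_nat s \<omega> \<in> B \<longleftrightarrow> \<omega> \<in> B"
    if "s \<in> space M" "\<omega> \<in> space S" for s \<omega>
    using that unbounded_walk_case_nat[of Y s \<omega>]
    by (auto simp: B_def space_PiM PiE_iff split: nat.split)
  define F where "F n = (\<lambda>(s, \<omega>). indicator B \<omega> * max (- run_max Y n \<omega>) (Y s))" for n
  have F_meas [measurable]: "F n \<in> borel_measurable (M \<Otimes>\<^sub>M S)" for n
    unfolding F_def by measurable
  have F_bound: "norm (F n z) \<le> \<bar>Y (fst z)\<bar>" for n z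
    using run_max_nonneg[of Y n "snd z"] by (auto simp: F_def indicator_def split: prod.splits)
  have snd_eq: "distr (M \<Otimes>\<^sub>M S) S snd = S"
    by (intro distr_pair_snd M.prob_space_axioms sigma_finite_measure_axioms)
  \<comment> \<open>The dominating function for the passage to the limit.\<close>
  have Y1: "integrable (M \<Otimes>\<^sub>M S) (\<lambda>z. Y (fst z))"
  proof -
    have "integrable (distr (M \<Otimes>\<^sub>M S) M fst) Y" using Y by (simp add: P.distr_pair_fst)
    then show ?thesis by (subst (asm) integrable_distr_eq) auto
  qed
  have F_int: "integrable (M \<Otimes>\<^sub>M S) (F n)" for n
    by (rule Bochner_Integration.integrable_bound[OF Y1]) (use F_bound in auto)
  have F_eq: "(\<integral>z. F n z \<partial>(M \<Otimes>\<^sub>M S)) = a (Suc n) - a n" for n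
  proof -
    have int2: "integrable (M \<Otimes>\<^sub>M S) (\<lambda>z. indicator B (snd z) * run_max Y n (snd z))"
      using int[of n] by (subst (asm) snd_eq[symmetric], subst (asm) integrable_distr_eq) auto
    have "a n = (\<integral>z. indicator B (snd z) * run_max Y n (snd z) \<partial>(M \<Otimes>\<^sub>M S))"
      unfolding a_def by (subst snd_eq[symmetric], subst integral_distr) auto
    then have int3: "(\<integral>z. F n z + indicator B (snd z) * run_max Y n (snd z) \<partial>(M \<Otimes>\<^sub>M S))
        = (\<integral>z. F n z \<partial>(M \<Otimes>\<^sub>M S)) + a n"
      by (simp add: F_int int2)
    have "a (Suc n) = (\<integral>(s, \<omega>). indicator B (case_nat s \<omega>) * run_max Y (Suc n) (case_nat s \<omega>) \<partial>(M \<Otimes>\<^sub>M S))"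
      unfolding a_def by (subst PiM_iter[symmetric], subst integral_distr) (auto simp: split_beta' simp del: run_max.simps)
    also have "\<dots> = (\<integral>z. F n z + indicator B (snd z) * run_max Y n (snd z) \<partial>(M \<Otimes>\<^sub>M S))"
      by (intro Bochner_Integration.integral_cong)
        (auto simp: F_def space_pair_measure B_shift indicator_def max_def)
    also have "\<dots> = (\<integral>z. F n z \<partial>(M \<Otimes>\<^sub>M S)) + a n"
      by (rule int3)
    finally show ?thesis by simp
  qed
  have a_mono: "a n \<le> a (Suc n)" for n
    unfolding a_def by (intro integral_mono int mult_left_mono run_max_mono) auto
  have "(\<lambda>n. \<integral>z. F n z \<partial>(M \<Otimes>\<^sub>M S)) \<longlonglongrightarrow> (\<integral>z. indicator B (snd z) * Y (fst z) \<partial>(M \<Otimes>\<^sub>M S))"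
  proof (rule integral_dominated_convergence[where w="\<lambda>z. \<bar>Y (fst z)\<bar>"])
    show "AE z in M \<Otimes>\<^sub>M S. (\<lambda>n. F n z) \<longlonglongrightarrow> indicator B (snd z) * Y (fst z)"
    proof (intro AE_I2)
      fix z assume "z \<in> space (M \<Otimes>\<^sub>M S)"
      show "(\<lambda>n. F n z) \<longlonglongrightarrow> indicator B (snd z) * Y (fst z)"
      proof (cases "snd z \<in> B")
        case True
        then have "eventually (\<lambda>n. - Y (fst z) \<le> run_max Y n (snd z)) sequentially"
          using run_max_at_top_if_unbounded by (auto simp: B_def filterlim_at_top)
        then have "eventually (\<lambda>n. F n z = indicator B (snd z) * Y (fst z)) sequentially"
          by eventually_elim (auto simp: F_def split_beta')
        then show ?thesis by (rule tendsto_eventually)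
      qed (auto simp: F_def split_beta')
    qed
  qed (use Y1 F_bound in auto)
  also have "(\<integral>z. indicator B (snd z) * Y (fst z) \<partial>(M \<Otimes>\<^sub>M S)) = measure S B * (\<integral>x. Y x \<partial>M)"
  proof -
    have "integrable (M \<Otimes>\<^sub>M S) (\<lambda>z. indicator B (snd z) * Y (fst z))"
      by (rule Bochner_Integration.integrable_bound[OF Y1]) (auto simp: indicator_def)
    from MS.integral_fst'[OF this] show ?thesis by (simp add: mult.commute)
  qed
  finally have "0 \<le> measure S B * (\<integral>x. Y x \<partial>M)"
    by (rule LIMSEQ_le_const) (use F_eq a_mono in auto)
  with neg have "measure S B = 0"
    by (smt (verit) measure_nonneg mult_pos_neg)
  then have "B \<in> null_sets S" by (simp add: null_sets_def emeasure_eq_measure)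
  then have "AE \<omega> in S. \<omega> \<notin> B" by (rule AE_not_in)
  then show ?thesis
    using AE_space by eventually_elim (auto simp: B_def unbounded_walk_iff not_less)
qed

end

section \<open>Conditioning on the past observations\<close>

text \<open>
  The expectation of a function of the past \<open>\<omega> 0, \<dots>, \<omega> (n - 1)\<close> and of the next observation \<open>\<omega> n\<close> may be
  computed by integrating out \<open>\<omega> n\<close> first: splicing two independent sequences at time \<open>n\<close> gives a
  sequence with the original law. It replaces conditional expectations given the past.
\<close>
lemma (in sequence_space) nn_integral_next_coordinate:
  assumes F [measurable]: "(\<lambda>(\<omega>, x). F \<omega> x) \<in> borel_measurable (S \<Otimes>\<^sub>M M)"
    and past: "\<And>\<omega> \<omega>' x. (\<And>i. i < n \<Longrightarrow> \<omega> i = \<omega>' i) \<Longrightarrow> F \<omega> x = F \<omega>' x"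
  shows "(\<integral>\<^sup>+\<omega>. F \<omega> (\<omega> n) \<partial>S) = (\<integral>\<^sup>+\<omega>. (\<integral>\<^sup>+x. F \<omega> x \<partial>M) \<partial>S)"
proof -
  interpret SS: pair_sigma_finite S S ..
  have "(\<integral>\<^sup>+\<omega>. F \<omega> (\<omega> n) \<partial>S) =
      (\<integral>\<^sup>+z. F (comb_seq n (fst z) (snd z)) (comb_seq n (fst z) (snd z) n) \<partial>(S \<Otimes>\<^sub>M S))"
    by (subst PiM_comb_seq[symmetric, of n], subst nn_integral_distr) (auto simp: split_beta')
  also have "\<dots> = (\<integral>\<^sup>+z. F (fst z) (snd z 0) \<partial>(S \<Otimes>\<^sub>M S))"
  proof (intro nn_integral_cong)
    fix z :: "(nat \<Rightarrow> 'a) \<times> (nat \<Rightarrow> 'a)"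
    have "comb_seq n (fst z) (snd z) n = snd z 0" by (simp add: comb_seq_def)
    then show "F (comb_seq n (fst z) (snd z)) (comb_seq n (fst z) (snd z) n) = F (fst z) (snd z 0)"
      using past[of "comb_seq n (fst z) (snd z)" "fst z"] by (simp add: comb_seq_less)
  qed
  also have "\<dots> = (\<integral>\<^sup>+\<omega>. (\<integral>\<^sup>+\<omega>'. F \<omega> (\<omega>' 0) \<partial>S) \<partial>S)"
    by (subst nn_integral_fst[symmetric]) auto
  also have "\<dots> = (\<integral>\<^sup>+\<omega>. (\<integral>\<^sup>+x. F \<omega> x \<partial>M) \<partial>S)"
  proof (intro nn_integral_cong)
    fix \<omega> assume [measurable]: "\<omega> \<in> space S"
    have "distr S M (\<lambda>\<omega>'. \<omega>' 0) = M"
      by (intro distr_PiM_component M.prob_space_axioms) auto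
    then have "(\<integral>\<^sup>+x. F \<omega> x \<partial>M) = (\<integral>\<^sup>+x. F \<omega> x \<partial>(distr S M (\<lambda>\<omega>'. \<omega>' 0)))" by simp
    also have "\<dots> = (\<integral>\<^sup>+\<omega>'. F \<omega> (\<omega>' 0) \<partial>S)"
      by (subst nn_integral_distr) auto
    finally show "(\<integral>\<^sup>+\<omega>'. F \<omega> (\<omega>' 0) \<partial>S) = (\<integral>\<^sup>+x. F \<omega> x \<partial>M)" ..
  qed
  finally show ?thesis .
qed

section \<open>Hellinger affinity\<close>

lemma densitiesD:
  assumes "f \<in> densities M"
  shows "f \<in> borel_measurable M" "integrable M f" "(\<integral>x. f x \<partial>M) = 1"
    "\<And>x. x \<in> space M \<Longrightarrow> 0 \<le> f x"
  using assms by (auto simp: densities_def)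

lemma
  assumes f: "f \<in> densities M" and g: "g \<in> densities M"
  shows integrable_sqrt_mult: "integrable M (\<lambda>x. sqrt (f x * g x))"
    and hellinger_affinity: "(\<integral>x. sqrt (f x * g x) \<partial>M) = 1 - (hellinger M f g)\<^sup>2 / 2"
proof -
  note [measurable] = densitiesD(1)[OF f] densitiesD(1)[OF g]
  note fd = densitiesD[OF f] and gd = densitiesD[OF g]
  show int: "integrable M (\<lambda>x. sqrt (f x * g x))"
  proof (rule Bochner_Integration.integrable_bound)
    show "integrable M (\<lambda>x. (f x + g x) / 2)" using fd gd by auto
    show "AE x in M. norm (sqrt (f x * g x)) \<le> norm ((f x + g x) / 2)"
      using fd(4) gd(4) arith_geo_mean_sqrt by (intro AE_I2) fastforce
  qed simp
  have "(\<integral>x. (sqrt (f x) - sqrt (g x))\<^sup>2 \<partial>M) = (\<integral>x. f x + g x - 2 * sqrt (f x * g x) \<partial>M)"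
    using fd(4) gd(4)
    by (intro Bochner_Integration.integral_cong) (auto simp: power2_diff real_sqrt_mult)
  also have "\<dots> = 2 - 2 * (\<integral>x. sqrt (f x * g x) \<partial>M)"
    using fd gd int by simp
  finally have *: "(\<integral>x. (sqrt (f x) - sqrt (g x))\<^sup>2 \<partial>M) = 2 - 2 * (\<integral>x. sqrt (f x * g x) \<partial>M)" .
  have "(hellinger M f g)\<^sup>2 = (\<integral>x. (sqrt (f x) - sqrt (g x))\<^sup>2 \<partial>M)"
    unfolding hellinger_def by (rule real_sqrt_pow2) (auto intro: integral_nonneg_AE)
  with * show "(\<integral>x. sqrt (f x * g x) \<partial>M) = 1 - (hellinger M f g)\<^sup>2 / 2" by linarith
qed

text \<open>
  Why the Hellinger distance enters: the mean of the square root of a likelihood ratio under the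
  denominator is the affinity. Where \<open>g\<close> vanishes, both \<open>g x * sqrt (f x / g x)\<close> and \<open>sqrt (f x * g x)\<close>
  are zero, so the mass that \<open>f\<close> puts there contributes to neither side.
\<close>
lemma nn_integral_sqrt_ratio:
  assumes f: "f \<in> densities M" and g: "g \<in> densities M"
  shows "(\<integral>\<^sup>+x. ennreal (sqrt (f x / g x)) \<partial>density M (\<lambda>x. ennreal (g x)))
    = ennreal (1 - (hellinger M f g)\<^sup>2 / 2)"
proof -
  note [measurable] = densitiesD(1)[OF f] densitiesD(1)[OF g]
  have "(\<integral>\<^sup>+x. ennreal (sqrt (f x / g x)) \<partial>density M (\<lambda>x. ennreal (g x)))
    = (\<integral>\<^sup>+x. ennreal (g x) * ennreal (sqrt (f x / g x)) \<partial>M)"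
    by (rule nn_integral_density) auto
  also have "\<dots> = (\<integral>\<^sup>+x. ennreal (sqrt (f x * g x)) \<partial>M)"
  proof (intro nn_integral_cong)
    fix x assume "x \<in> space M"
    then have nn: "0 \<le> f x" "0 \<le> g x" using densitiesD(4)[OF f] densitiesD(4)[OF g] by auto
    have "g x * sqrt (f x / g x) = sqrt (f x * g x)"
      using nn real_sqrt_mult_self[of "g x"]
      by (cases "g x = 0") (auto simp: real_sqrt_mult real_sqrt_divide field_simps)
    then show "ennreal (g x) * ennreal (sqrt (f x / g x)) = ennreal (sqrt (f x * g x))"
      using nn by (metis ennreal_mult divide_nonneg_nonneg real_sqrt_ge_zero)
  qed
  also have "\<dots> = ennreal (1 - (hellinger M f g)\<^sup>2 / 2)"
    using densitiesD(4)[OF f] densitiesD(4)[OF g]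
    by (subst nn_integral_eq_integral[OF integrable_sqrt_mult[OF f g]])
      (auto simp: hellinger_affinity[OF f g])
  finally show ?thesis .
qed

section \<open>Likelihoods and predictive densities\<close>

lemma lik_ratio_Suc: "lik_ratio f0 (Suc n) \<omega> f = lik_ratio f0 n \<omega> f * (f (\<omega> n) / f0 (\<omega> n))"
  by (simp add: lik_ratio_def)

lemma lik_ratio_cong_past:
  "(\<And>i. i < n \<Longrightarrow> \<omega> i = \<omega>' i) \<Longrightarrow> lik_ratio f0 n \<omega> = lik_ratio f0 n \<omega>'"
  by (auto simp: lik_ratio_def fun_eq_iff)

lemma restr_lik_cong_past:
  "(\<And>i. i < n \<Longrightarrow> \<omega> i = \<omega>' i) \<Longrightarrow> restr_lik P f0 A n \<omega> = restr_lik P f0 A n \<omega>'"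
  by (simp add: restr_lik_def lik_ratio_cong_past[of n \<omega> \<omega>'])

lemma predictive_cong_past:
  "(\<And>i. i < n \<Longrightarrow> \<omega> i = \<omega>' i) \<Longrightarrow> predictive P f0 A n \<omega> = predictive P f0 A n \<omega>'"
  by (simp add: predictive_def restr_lik_cong_past[of n \<omega> \<omega>'] lik_ratio_cong_past[of n \<omega> \<omega>'] fun_eq_iff)

text \<open>
  Up to its initial value, the restricted likelihood is thus the likelihood ratio of the sequence of
  predictive densities against \<open>f0\<close>, as if the data were predicted one at a time.
\<close>
lemma restr_lik_Suc:
  assumes "restr_lik P f0 A n \<omega> \<noteq> 0"
  shows "restr_lik P f0 A (Suc n) \<omega>
    = restr_lik P f0 A n \<omega> * (predictive P f0 A n \<omega> (\<omega> n) / f0 (\<omega> n))"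
proof -
  have "restr_lik P f0 A (Suc n) \<omega> = (LINT f:A|P. (1 / f0 (\<omega> n)) * (f (\<omega> n) * lik_ratio f0 n \<omega> f))"
    by (simp add: restr_lik_def lik_ratio_Suc mult_ac)
  also have "\<dots> = (1 / f0 (\<omega> n)) * (LINT f:A|P. f (\<omega> n) * lik_ratio f0 n \<omega> f)"
    by (rule set_integral_mult_right)
  finally show ?thesis using assms by (simp add: predictive_def)
qed

section \<open>The Bayesian model\<close>

locale bayes_model =
  fixes M :: "'a measure" and f0 :: "'a \<Rightarrow> real" and P :: "('a \<Rightarrow> real) measure"
  assumes sigma_finite: "sigma_finite_measure M"
    and f0: "f0 \<in> densities M"
    and prior: "is_prior M P"
begin

abbreviation F0 :: "'a measure" where "F0 \<equiv> density M (\<lambda>x. ennreal (f0 x))"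

abbreviation law :: "(nat \<Rightarrow> 'a) measure" where "law \<equiv> \<Pi>\<^sub>M i\<in>UNIV. F0"

lemma seq_law_eq: "seq_law M f0 = law"
  by (simp add: seq_law_def)

lemma prob_space_F0: "prob_space F0"
proof
  have "emeasure F0 (space F0) = (\<integral>\<^sup>+x. ennreal (f0 x) \<partial>M)"
    using densitiesD(1)[OF f0] by (subst emeasure_density) (auto intro!: nn_integral_cong)
  also have "\<dots> = 1"
    using densitiesD[OF f0] by (subst nn_integral_eq_integral) auto
  finally show "emeasure F0 (space F0) = 1" .
qed

sublocale M: sigma_finite_measure M by (rule sigma_finite)

sublocale P: prob_space P using prior by (simp add: is_prior_def)

sublocale data: sequence_space F0
proof -
  interpret F0: prob_space F0 by (rule prob_space_F0)
  show "sequence_space F0" by unfold_locales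
qed

lemma measurable_f0 [measurable]: "f0 \<in> borel_measurable M"
  by (rule densitiesD(1)[OF f0])

lemma prior_densities: "f \<in> space P \<Longrightarrow> f \<in> densities M"
  using prior by (auto simp: is_prior_def)

lemma measurable_eval [measurable (raw)]:
  assumes f: "f \<in> measurable N P" and g: "g \<in> measurable N M"
  shows "(\<lambda>z. (f z) (g z)) \<in> borel_measurable N"
proof -
  have "(\<lambda>(f, x). f x) \<in> borel_measurable (P \<Otimes>\<^sub>M M)"
    using prior by (simp add: is_prior_def)
  from measurable_compose[OF measurable_Pair[OF f g] this] show ?thesis by simp
qed

lemma measurable_observation [measurable]: "(\<lambda>\<omega>. \<omega> i) \<in> measurable law M"
  using measurable_component_singleton[of i UNIV "\<lambda>_. F0"] by simp

lemma space_law: "\<omega> \<in> space law \<Longrightarrow> \<omega> i \<in> space M"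
  by (auto simp: space_PiM PiE_iff)

lemma measurable_lik_ratio [measurable (raw)]:
  assumes [measurable]: "w \<in> measurable N law" "f \<in> measurable N P"
  shows "(\<lambda>z. lik_ratio f0 n (w z) (f z)) \<in> borel_measurable N"
  unfolding lik_ratio_def by measurable

lemma lik_ratio_nonneg: "\<omega> \<in> space law \<Longrightarrow> f \<in> space P \<Longrightarrow> 0 \<le> lik_ratio f0 n \<omega> f"
  unfolding lik_ratio_def using densitiesD(4)[OF f0] densitiesD(4)[OF prior_densities]
  by (intro prod_nonneg) (auto intro!: divide_nonneg_nonneg simp: space_law)

end

locale restricted_bayes_model = bayes_model +
  fixes A :: "('a \<Rightarrow> real) set"
  assumes A [measurable]: "A \<in> sets P"
begin

abbreviation L :: "nat \<Rightarrow> (nat \<Rightarrow> 'a) \<Rightarrow> real" where "L \<equiv> restr_lik P f0 A"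

abbreviation p :: "nat \<Rightarrow> (nat \<Rightarrow> 'a) \<Rightarrow> 'a \<Rightarrow> real" where "p \<equiv> predictive P f0 A"

lemma measurable_L [measurable]: "L n \<in> borel_measurable law"
  unfolding restr_lik_def set_lebesgue_integral_def by measurable

lemma measurable_predictive [measurable]:
  "(\<lambda>(\<omega>, x). p n \<omega> x) \<in> borel_measurable (law \<Otimes>\<^sub>M M)"
proof -
  have [measurable]: "(\<lambda>z. L n (fst z)) \<in> borel_measurable (law \<Otimes>\<^sub>M M)" by measurable
  show ?thesis
    unfolding predictive_def split_beta' set_lebesgue_integral_def by measurable
qed

lemma measurable_hellinger [measurable]:
  "(\<lambda>\<omega>. hellinger M (p n \<omega>) f0) \<in> borel_measurable law"
  unfolding hellinger_def by measurable

lemma L_nonneg: "\<omega> \<in> space law \<Longrightarrow> 0 \<le> L n \<omega>"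
  unfolding restr_lik_def set_lebesgue_integral_def
  by (intro integral_nonneg_AE AE_I2) (auto simp: lik_ratio_nonneg indicator_def)

text \<open>
  Positivity of \<open>L n \<omega>\<close> does double duty: it makes the quotient meaningful, and, as the integral of
  a non-integrable function is zero, it forces the restricted likelihood to be integrable, so that
  Fubini's theorem applies to \<open>f x * R_n(f)\<close> for this very \<open>\<omega>\<close>.
\<close>
lemma predictive_density:
  assumes \<omega> [measurable]: "\<omega> \<in> space law" and pos: "0 < L n \<omega>"
  shows "p n \<omega> \<in> densities M"
proof -
  interpret PM: pair_sigma_finite P M ..
  have L_int: "integrable P (\<lambda>f. indicator A f * lik_ratio f0 n \<omega> f)"
    using pos not_integrable_integral_eq[of P "\<lambda>f. indicator A f *\<^sub>R lik_ratio f0 n \<omega> f"]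
    by (auto simp: restr_lik_def set_lebesgue_integral_def)
  have joint: "integrable (P \<Otimes>\<^sub>M M) (\<lambda>(f, x). indicator A f * (f x * lik_ratio f0 n \<omega> f))"
  proof (rule PM.Fubini_integrable)
    have "(\<integral>x. norm (indicator A f * (f x * lik_ratio f0 n \<omega> f)) \<partial>M)
        = indicator A f * lik_ratio f0 n \<omega> f" if f: "f \<in> space P" for f
    proof -
      have "(\<integral>x. norm (indicator A f * (f x * lik_ratio f0 n \<omega> f)) \<partial>M)
        = (\<integral>x. (indicator A f * lik_ratio f0 n \<omega> f) * f x \<partial>M)"
        using densitiesD(4)[OF prior_densities[OF f]] lik_ratio_nonneg[OF \<omega> f]
        by (intro Bochner_Integration.integral_cong) (auto simp: abs_mult)
      then show ?thesis using densitiesD(3)[OF prior_densities[OF f]] by simp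
    qed
    with L_int show "integrable P (\<lambda>f. \<integral>x. norm (case (f, x) of (f, x) \<Rightarrow> indicator A f * (f x * lik_ratio f0 n \<omega> f)) \<partial>M)"
      by (simp cong: Bochner_Integration.integrable_cong)
    show "AE f in P. integrable M (\<lambda>x. case (f, x) of (f, x) \<Rightarrow> indicator A f * (f x * lik_ratio f0 n \<omega> f))"
      using densitiesD(2)[OF prior_densities] by (intro AE_I2) simp
  qed measurable
  have num: "(LINT f:A|P. f x * lik_ratio f0 n \<omega> f)
      = (\<integral>f. indicator A f * (f x * lik_ratio f0 n \<omega> f) \<partial>P)" for x
    by (simp add: set_lebesgue_integral_def)
  have "(\<integral>x. (\<integral>f. indicator A f * (f x * lik_ratio f0 n \<omega> f) \<partial>P) \<partial>M)
      = (\<integral>f. (\<integral>x. indicator A f * (f x * lik_ratio f0 n \<omega> f) \<partial>M) \<partial>P)"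
    by (rule PM.Fubini_integral[OF joint])
  also have "\<dots> = L n \<omega>"
    unfolding restr_lik_def set_lebesgue_integral_def
    using densitiesD(3)[OF prior_densities] by (intro Bochner_Integration.integral_cong) auto
  finally have "(\<integral>x. p n \<omega> x \<partial>M) = 1"
    using pos by (simp add: predictive_def num)
  moreover have "integrable M (p n \<omega>)"
    using PM.integrable_snd[OF joint] by (simp add: predictive_def[abs_def] num)
  moreover have "0 \<le> p n \<omega> x" if x: "x \<in> space M" for x
    unfolding predictive_def num using pos x densitiesD(4)[OF prior_densities] lik_ratio_nonneg[OF \<omega>]
    by (auto intro!: divide_nonneg_nonneg integral_nonneg_AE AE_I2 mult_nonneg_nonneg)
  ultimately show ?thesis by (simp add: densities_def)
qed

section \<open>The square root of the restricted likelihood\<close>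

text \<open>
  The affinity of the predictive density and the truth. The lower bound \<open>1 / 2\<close> guards against
  division by zero below; any constant in \<open>(0, 1)\<close> would do, since all that matters is that the factor
  dominates the affinity and is bounded away from 1 whenever the affinity is.
\<close>
definition damping :: "nat \<Rightarrow> (nat \<Rightarrow> 'a) \<Rightarrow> real" where
  "damping n \<omega> = max (1 / 2) (1 - (hellinger M (p n \<omega>) f0)\<^sup>2 / 2)"

text \<open>
  By the recursion for \<open>L\<close>, the square root of \<open>L n\<close> is multiplied, on average given the past, by
  the affinity at each step. Dividing by factors that dominate the affinities leaves a nonnegative
  supermartingale.
\<close>
definition damped_root :: "nat \<Rightarrow> (nat \<Rightarrow> 'a) \<Rightarrow> real" where
  "damped_root n \<omega> = sqrt (L n \<omega>) / (\<Prod>k<n. damping k \<omega>)"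

lemma damping_pos: "0 < damping n \<omega>"
  by (simp add: damping_def less_max_iff_disj)

lemma damping_le_1: "damping n \<omega> \<le> 1"
  by (simp add: damping_def)

lemma measurable_damping [measurable]: "damping n \<in> borel_measurable law"
  unfolding damping_def by measurable

lemma measurable_damped_root [measurable]: "damped_root n \<in> borel_measurable law"
  unfolding damped_root_def by measurable

lemma damped_root_nonneg: "\<omega> \<in> space law \<Longrightarrow> 0 \<le> damped_root n \<omega>"
  unfolding damped_root_def using damping_pos by (intro divide_nonneg_nonneg prod_nonneg)
    (auto simp: L_nonneg less_imp_le)

lemma damping_cong_past:
  "(\<And>i. i < n \<Longrightarrow> \<omega> i = \<omega>' i) \<Longrightarrow> damping n \<omega> = damping n \<omega>'"
  by (simp add: damping_def predictive_cong_past[of n \<omega> \<omega>'])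

lemma damped_root_cong_past:
  assumes "\<And>i. i < n \<Longrightarrow> \<omega> i = \<omega>' i"
  shows "damped_root n \<omega> = damped_root n \<omega>'"
proof -
  have "damping k \<omega> = damping k \<omega>'" if "k < n" for k
    using assms that by (intro damping_cong_past) auto
  then show ?thesis using restr_lik_cong_past[of n \<omega> \<omega>' P f0 A] assms by (simp add: damped_root_def)
qed

text \<open>
  The supermartingale step: by the recursion for \<open>L\<close>, the next value is the present one times
  \<open>sqrt (p n \<omega> (\<omega> n) / f0 (\<omega> n)) / damping n \<omega>\<close>, and integrating out \<open>\<omega> n\<close> turns the root into the
  affinity, which the damping factor dominates.
\<close>
lemma nn_integral_damped_root_Suc:
  assumes pos: "AE \<omega> in law. 0 < L n \<omega>"
  shows "(\<integral>\<^sup>+\<omega>. ennreal (damped_root (Suc n) \<omega>) \<partial>law) \<le> (\<integral>\<^sup>+\<omega>. ennreal (damped_root n \<omega>) \<partial>law)"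
proof -
  define F where "F \<omega> x = ennreal (damped_root n \<omega> / damping n \<omega> * sqrt (p n \<omega> x / f0 x))" for \<omega> x
  have sets_eq: "sets (law \<Otimes>\<^sub>M F0) = sets (law \<Otimes>\<^sub>M M)" by (intro sets_pair_measure_cong) auto
  have "(\<lambda>(\<omega>, x). F \<omega> x) \<in> borel_measurable (law \<Otimes>\<^sub>M M)"
    unfolding F_def by measurable
  then have F: "(\<lambda>(\<omega>, x). F \<omega> x) \<in> borel_measurable (law \<Otimes>\<^sub>M F0)"
    using measurable_cong_sets[OF sets_eq refl] by blast
  have past: "F \<omega> x = F \<omega>' x" if "\<And>i. i < n \<Longrightarrow> \<omega> i = \<omega>' i" for \<omega> \<omega>' x
    using that by (simp add: F_def damped_root_cong_past[of n \<omega> \<omega>'] damping_cong_past[of n \<omega> \<omega>']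
      predictive_cong_past[of n \<omega> \<omega>'])
  have "(\<integral>\<^sup>+\<omega>. ennreal (damped_root (Suc n) \<omega>) \<partial>law) = (\<integral>\<^sup>+\<omega>. F \<omega> (\<omega> n) \<partial>law)"
  proof (intro nn_integral_cong_AE)
    show "AE \<omega> in law. ennreal (damped_root (Suc n) \<omega>) = F \<omega> (\<omega> n)"
      using pos by eventually_elim (simp add: F_def damped_root_def restr_lik_Suc flip: real_sqrt_mult)
  qed
  also have "\<dots> = (\<integral>\<^sup>+\<omega>. (\<integral>\<^sup>+x. F \<omega> x \<partial>F0) \<partial>law)"
    by (rule data.nn_integral_next_coordinate[OF F past])
  also have "\<dots> \<le> (\<integral>\<^sup>+\<omega>. ennreal (damped_root n \<omega>) \<partial>law)"
  proof (intro nn_integral_mono_AE)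
    show "AE \<omega> in law. (\<integral>\<^sup>+x. F \<omega> x \<partial>F0) \<le> ennreal (damped_root n \<omega>)"
      using pos AE_space
    proof eventually_elim
      case (elim \<omega>)
      note \<omega> [measurable] = elim(2)
      have dens: "p n \<omega> \<in> densities M" using elim by (intro predictive_density)
      note [measurable] = densitiesD(1)[OF dens]
      have c: "0 \<le> damped_root n \<omega> / damping n \<omega>"
        using damped_root_nonneg[OF \<omega>] damping_pos[of n \<omega>] by (simp add: less_imp_le)
      have "(\<integral>\<^sup>+x. F \<omega> x \<partial>F0) = (\<integral>\<^sup>+x. ennreal (damped_root n \<omega> / damping n \<omega>) * ennreal (sqrt (p n \<omega> x / f0 x)) \<partial>F0)"
        by (simp only: F_def ennreal_mult'[OF c])
      also have "\<dots> = ennreal (damped_root n \<omega> / damping n \<omega>) * ennreal (1 - (hellinger M (p n \<omega>) f0)\<^sup>2 / 2)"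
        by (subst nn_integral_cmult) (auto simp: nn_integral_sqrt_ratio[OF dens f0])
      also have "\<dots> \<le> ennreal (damped_root n \<omega> / damping n \<omega>) * ennreal (damping n \<omega>)"
        by (intro mult_left_mono ennreal_leI) (auto simp: damping_def)
      also have "\<dots> = ennreal (damped_root n \<omega>)"
        using c damping_pos[of n \<omega>] by (simp flip: ennreal_mult)
      finally show ?case .
    qed
  qed
  finally show ?thesis .
qed

lemma nn_integral_damped_root_le_1:
  assumes pos: "\<forall>n. AE \<omega> in law. 0 < L n \<omega>"
  shows "(\<integral>\<^sup>+\<omega>. ennreal (damped_root n \<omega>) \<partial>law) \<le> 1"
proof (induction n)
  case 0
  have "damped_root 0 \<omega> = sqrt (measure P A)" for \<omega>
    by (simp add: damped_root_def restr_lik_def lik_ratio_def set_lebesgue_integral_def)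
  then show ?case by (simp add: data.emeasure_space_1)
next
  case (Suc n)
  with nn_integral_damped_root_Suc[of n] pos show ?case by (meson order_trans)
qed

text \<open>
  Since the means are bounded, the series of the values weighted by \<open>exp (- \<eta> n)\<close> has
  finite mean, so it is finite almost surely and bounds each of its terms. This is weaker than
  almost sure convergence of the supermartingale, but exponential decay is what it competes with.
\<close>
lemma AE_damped_root_subexponential:
  assumes pos: "\<forall>n. AE \<omega> in law. 0 < L n \<omega>" and "0 < \<eta>"
  shows "AE \<omega> in law. \<exists>C. \<forall>n. damped_root n \<omega> \<le> C * exp (\<eta> * real n)"
proof -
  define W where "W \<omega> = (\<Sum>n. ennreal (exp (- \<eta>) ^ n) * ennreal (damped_root n \<omega>))" for \<omega>
  have "(\<integral>\<^sup>+\<omega>. W \<omega> \<partial>law) = (\<Sum>n. \<integral>\<^sup>+\<omega>. ennreal (exp (- \<eta>) ^ n) * ennreal (damped_root n \<omega>) \<partial>law)"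
    unfolding W_def by (rule nn_integral_suminf) measurable
  also have "\<dots> = (\<Sum>n. ennreal (exp (- \<eta>) ^ n) * (\<integral>\<^sup>+\<omega>. ennreal (damped_root n \<omega>) \<partial>law))"
    by (subst nn_integral_cmult) auto
  also have "\<dots> \<le> (\<Sum>n. ennreal (exp (- \<eta>) ^ n))"
    using mult_left_mono[OF nn_integral_damped_root_le_1[OF pos]] by (intro suminf_le) auto
  also have "\<dots> < \<top>"
    using \<open>0 < \<eta>\<close> by (subst suminf_ennreal2) (auto intro!: summable_geometric)
  finally have "AE \<omega> in law. W \<omega> \<noteq> \<infinity>"
    by (intro nn_integral_PInf_AE) (auto simp: W_def)
  then show ?thesis
    using AE_space
  proof eventually_elim
    case (elim \<omega>)
    have "damped_root n \<omega> \<le> enn2real (W \<omega>) * exp (\<eta> * real n)" for n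
    proof -
      have "ennreal (exp (- \<eta>) ^ n) * ennreal (damped_root n \<omega>) \<le> W \<omega>"
        using sum_le_suminf[of "\<lambda>n. ennreal (exp (- \<eta>) ^ n) * ennreal (damped_root n \<omega>)" "{n}"]
        by (simp add: W_def)
      then have "ennreal (exp (- \<eta>) ^ n * damped_root n \<omega>) \<le> ennreal (enn2real (W \<omega>))"
        using elim damped_root_nonneg[of \<omega> n] by (simp add: ennreal_mult less_top)
      then have "exp (- \<eta>) ^ n * damped_root n \<omega> \<le> enn2real (W \<omega>)" by simp
      then show ?thesis
        by (simp add: exp_minus field_simps exp_of_nat2_mult)
    qed
    then show ?case by blast
  qed
qed

end

section \<open>The Kullback-Leibler property bounds the evidence from below\<close>

context bayes_model
begin

text \<open>
  If \<open>f\<close> is within divergence \<open>\<epsilon>\<close> of \<open>f0\<close>, then the log-likelihood ratio of \<open>f0\<close> against \<open>f\<close> is a random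
  walk whose drift is below \<open>\<epsilon>\<close>. The positive part of the integrand has finite integral because the
  divergence is finite, and the negative part because \<open>ln t \<le> t\<close> bounds \<open>f0 ln (f / f0)\<close> by \<open>f\<close>.
\<close>
lemma kl_log_ratio:
  assumes f: "f \<in> space P" and kl: "kl_div M f f0 < ereal \<epsilon>"
  shows "AE x in F0. 0 < f x \<and> 0 < f0 x"
    and "integrable F0 (\<lambda>x. ln (f0 x / f x) - \<epsilon>)"
    and "(\<integral>x. ln (f0 x / f x) - \<epsilon> \<partial>F0) < 0"
proof -
  have [measurable]: "f \<in> borel_measurable M"
    by (rule densitiesD(1)[OF prior_densities[OF f]])
  define k where "k x = f0 x * ln (f0 x / f x)" for x
  have [measurable]: "k \<in> borel_measurable M" unfolding k_def by measurable
  have [measurable]: "kl_integrand f f0 \<in> borel_measurable M"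
    unfolding kl_integrand_def[abs_def] by measurable
  define pos where "pos = (\<integral>\<^sup>+x. e2ennreal (kl_integrand f f0 x) \<partial>M)"
  define neg where "neg = (\<integral>\<^sup>+x. e2ennreal (- kl_integrand f f0 x) \<partial>M)"
  have diff: "enn2ereal pos - enn2ereal neg < ereal \<epsilon>"
    using kl by (simp add: kl_div_def pos_def neg_def)
  then have pos_fin: "pos \<noteq> \<infinity>" by auto
  then have "AE x in M. e2ennreal (kl_integrand f f0 x) \<noteq> \<infinity>"
    unfolding pos_def by (intro nn_integral_PInf_AE) auto
  \<comment> \<open>Where \<open>f\<close> vanishes and \<open>f0\<close> does not, the integrand is infinite.\<close>
  then have supp: "AE x in M. 0 < f0 x \<longrightarrow> 0 < f x"
    using AE_space
  proof eventually_elim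
    case (elim x)
    have "0 \<le> f x" using densitiesD(4)[OF prior_densities[OF f]] elim by auto
    with elim show ?case by (cases "f x = 0") (auto simp: kl_integrand_def)
  qed
  then show pos_F0: "AE x in F0. 0 < f x \<and> 0 < f0 x"
    by (subst AE_density) (auto elim!: eventually_mono)
  have kl_k: "AE x in M. kl_integrand f f0 x = ereal (k x)"
    using supp AE_space
    by eventually_elim (use densitiesD(4)[OF f0] in \<open>fastforce simp: kl_integrand_def k_def\<close>)
  have pos_k: "pos = (\<integral>\<^sup>+x. ennreal (k x) \<partial>M)"
    unfolding pos_def using kl_k by (intro nn_integral_cong_AE) (auto elim!: eventually_mono)
  have neg_k: "neg = (\<integral>\<^sup>+x. ennreal (- k x) \<partial>M)"
    unfolding neg_def using kl_k by (intro nn_integral_cong_AE) (auto elim!: eventually_mono)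
  have "neg \<le> (\<integral>\<^sup>+x. ennreal (f x) \<partial>M)"
    unfolding neg_k
  proof (intro nn_integral_mono_AE)
    show "AE x in M. ennreal (- k x) \<le> ennreal (f x)"
      using supp AE_space
    proof eventually_elim
      case (elim x)
      have nn: "0 \<le> f0 x" "0 \<le> f x"
        using densitiesD(4)[OF f0] densitiesD(4)[OF prior_densities[OF f]] elim by auto
      show ?case
      proof (cases "f0 x = 0")
        case False
        then have p: "0 < f0 x" "0 < f x" using nn elim by auto
        then have "- k x = f0 x * ln (f x / f0 x)" by (simp add: k_def ln_div algebra_simps)
        also have "\<dots> \<le> f0 x * (f x / f0 x)"
          using p ln_le_minus_one[of "f x / f0 x"] by (intro mult_left_mono) auto
        finally show ?thesis using p by (intro ennreal_leI) simp
      qed (simp add: k_def)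
    qed
  qed
  also have "\<dots> < \<infinity>"
    using densitiesD[OF prior_densities[OF f]] by (subst nn_integral_eq_integral) auto
  finally have neg_fin: "neg \<noteq> \<infinity>" by simp
  have k_int: "integrable M k"
    using pos_fin neg_fin by (simp add: real_integrable_def pos_k neg_k)
  have k_val: "(\<integral>x. k x \<partial>M) < \<epsilon>"
  proof -
    have "(\<integral>x. k x \<partial>M) = enn2real pos - enn2real neg"
      using real_lebesgue_integral_def[OF k_int] by (simp add: pos_k neg_k)
    with diff pos_fin neg_fin show ?thesis
      by (cases pos; cases neg) (auto simp: enn2ereal_ennreal)
  qed
  have log_int: "integrable F0 (\<lambda>x. ln (f0 x / f x))"
    using k_int densitiesD(4)[OF f0]
    by (subst integrable_density) (auto simp: k_def[abs_def])
  show "integrable F0 (\<lambda>x. ln (f0 x / f x) - \<epsilon>)" using log_int by simp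
  have "(\<integral>x. ln (f0 x / f x) \<partial>F0) = (\<integral>x. k x \<partial>M)"
    using densitiesD(4)[OF f0] by (subst integral_density) (auto simp: k_def[abs_def])
  then show "(\<integral>x. ln (f0 x / f x) - \<epsilon> \<partial>F0) < 0"
    using k_val log_int by (simp add: data.M.prob_space[simplified])
qed

text \<open>
  The logarithm of the constant is a negated natural number so that the densities that admit a given
  constant form one of countably many measurable sets.
\<close>
lemma AE_lik_ratio_lower_bound:
  assumes f: "f \<in> space P" and kl: "kl_div M f f0 < ereal \<epsilon>"
  shows "AE \<omega> in law. \<exists>k::nat. \<forall>n. exp (- real k - \<epsilon> * real n) \<le> lik_ratio f0 n \<omega> f"
proof -
  have "AE \<omega> in law. 0 < f (\<omega> i) \<and> 0 < f0 (\<omega> i)" for i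
    using kl_log_ratio(1)[OF f kl] by (intro AE_PiM_component prob_space_F0) auto
  then have "AE \<omega> in law. \<forall>i. 0 < f (\<omega> i) \<and> 0 < f0 (\<omega> i)"
    by (simp add: AE_all_countable)
  with data.AE_bounded_walk[OF kl_log_ratio(2,3)[OF f kl]] show ?thesis
  proof eventually_elim
    case (elim \<omega>)
    then obtain C where C: "\<And>n. (\<Sum>i<n. ln (f0 (\<omega> i) / f (\<omega> i)) - \<epsilon>) \<le> C" by blast
    obtain k where k: "C \<le> real k" using real_arch_simple by blast
    have "exp (- real k - \<epsilon> * real n) \<le> lik_ratio f0 n \<omega> f" for n
    proof -
      have "lik_ratio f0 n \<omega> f = exp (\<Sum>i<n. - ln (f0 (\<omega> i) / f (\<omega> i)))"
        unfolding lik_ratio_def exp_sum[OF finite_lessThan]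
        using elim(2) by (intro prod.cong) (auto simp: exp_minus)
      moreover have "(\<Sum>i<n. ln (f0 (\<omega> i) / f (\<omega> i))) \<le> real k + \<epsilon> * real n"
        using C[of n] k by (simp add: sum_subtractf mult.commute)
      ultimately show ?thesis by (simp add: sum_negf)
    qed
    then show ?case by blast
  qed
qed

text \<open>
  Each density in the Kullback-Leibler neighbourhood \<open>K\<close> satisfies the pointwise lower bound for
  almost all data, with a constant \<open>exp (- k)\<close> that depends on the density and the data. Swapping the
  two quantifiers by Fubini, for almost all data the sets \<open>V k\<close> of densities that admit the
  constant \<open>k\<close> cover almost all of \<open>K\<close>; as \<open>K\<close> has positive prior mass, so does some \<open>V k\<close>, and it alone
  contributes enough to the integral.
\<close>
lemma AE_evidence_lower_bound:
  assumes kl: "kl_property M P f0" and "0 < \<epsilon>"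
  shows "AE \<omega> in law. \<exists>c>0. \<forall>n.
    ennreal (c * exp (- \<epsilon> * real n)) \<le> (\<integral>\<^sup>+f. ennreal (lik_ratio f0 n \<omega> f) \<partial>P)"
proof -
  define K where "K = {f \<in> space P. kl_div M f f0 < ereal \<epsilon>}"
  have K_pos: "0 < measure P K"
    using kl \<open>0 < \<epsilon>\<close> by (simp add: kl_property_def K_def)
  \<comment> \<open>A set that is not measurable would have measure zero.\<close>
  then have K [measurable]: "K \<in> sets P"
    using measure_notin_sets[of K P] by fastforce
  interpret PL: pair_sigma_finite P law ..
  define V where "V k \<omega> = {f \<in> space P. f \<in> K \<and> (\<forall>n. exp (- real k - \<epsilon> * real n) \<le> lik_ratio f0 n \<omega> f)}"
    for k :: nat and \<omega>
  have swap: "AE f in P. AE \<omega> in law. f \<in> K \<longrightarrow> (\<exists>k. f \<in> V k \<omega>)"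
  proof (rule AE_I2)
    fix f assume "f \<in> space P"
    then show "AE \<omega> in law. f \<in> K \<longrightarrow> (\<exists>k. f \<in> V k \<omega>)"
      using AE_lik_ratio_lower_bound[of f \<epsilon>] by (cases "f \<in> K") (auto simp: K_def V_def)
  qed
  have comm: "{z \<in> space (P \<Otimes>\<^sub>M law). fst z \<in> K \<longrightarrow> (\<exists>k. fst z \<in> V k (snd z))} \<in> sets (P \<Otimes>\<^sub>M law)"
    unfolding V_def by measurable
  have "AE \<omega> in law. AE f in P. f \<in> K \<longrightarrow> (\<exists>k. f \<in> V k \<omega>)"
    using swap unfolding PL.AE_commute[OF comm] .
  then show ?thesis
    using AE_space
  proof eventually_elim
    case (elim \<omega>)
    note \<omega> [measurable] = elim(2)
    have V [measurable]: "V k \<omega> \<in> sets P" for k unfolding V_def by measurable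
    have "\<exists>k. measure P (V k \<omega>) \<noteq> 0"
    proof (rule ccontr)
      assume "\<not> ?thesis"
      then have "V k \<omega> \<in> null_sets P" for k by (simp add: null_sets_def P.emeasure_eq_measure)
      then have "AE f in P. \<forall>k. f \<notin> V k \<omega>" by (subst AE_all_countable) (auto intro: AE_not_in)
      with elim(1) have "AE f in P. f \<notin> K" by eventually_elim auto
      then have "K \<in> null_sets P" by (simp add: AE_iff_null_sets[OF K])
      then have "measure P K = 0" by (simp add: null_sets_def measure_def)
      with K_pos show False by simp
    qed
    then obtain k where k: "0 < measure P (V k \<omega>)" by (metis measure_nonneg order_less_le)
    have "ennreal (exp (- real k) * measure P (V k \<omega>) * exp (- \<epsilon> * real n))
        \<le> (\<integral>\<^sup>+f. ennreal (lik_ratio f0 n \<omega> f) \<partial>P)" for n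
    proof -
      have "ennreal (exp (- real k) * measure P (V k \<omega>) * exp (- \<epsilon> * real n))
          = ennreal (exp (- real k - \<epsilon> * real n)) * emeasure P (V k \<omega>)"
        by (simp add: P.emeasure_eq_measure ennreal_mult[symmetric] exp_diff exp_minus field_simps)
      also have "\<dots> = (\<integral>\<^sup>+f. ennreal (exp (- real k - \<epsilon> * real n)) * indicator (V k \<omega>) f \<partial>P)"
        by (rule nn_integral_cmult_indicator[symmetric]) (rule V)
      also have "\<dots> \<le> (\<integral>\<^sup>+f. ennreal (lik_ratio f0 n \<omega> f) \<partial>P)"
        by (intro nn_integral_mono) (auto simp: V_def indicator_def intro: ennreal_leI)
      finally show ?thesis .
    qed
    with k show ?case by (intro exI[of _ "exp (- real k) * measure P (V k \<omega>)"]) auto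
  qed
qed

end

section \<open>Posterior consistency\<close>

context restricted_bayes_model
begin

text \<open>
  If the evidence integral diverges, then its real value is zero and so is the quotient that
  defines the posterior; the upper bound is true in that case as well.
\<close>
lemma posterior_le:
  assumes \<omega>: "\<omega> \<in> space law" and "0 < b"
    and b: "ennreal b \<le> (\<integral>\<^sup>+f. ennreal (lik_ratio f0 n \<omega> f) \<partial>P)"
  shows "0 \<le> posterior P f0 n \<omega> A" "posterior P f0 n \<omega> A \<le> L n \<omega> / b"
proof -
  let ?I = "\<integral>f. lik_ratio f0 n \<omega> f \<partial>P"
  have nn: "0 \<le> ?I" by (intro integral_nonneg_AE AE_I2 lik_ratio_nonneg[OF \<omega>])
  then show "0 \<le> posterior P f0 n \<omega> A"
    unfolding posterior_def using L_nonneg[OF \<omega>] by (rule divide_nonneg_nonneg[rotated])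
  show "posterior P f0 n \<omega> A \<le> L n \<omega> / b"
  proof (cases "?I = 0")
    case True
    then show ?thesis using L_nonneg[OF \<omega>] \<open>0 < b\<close> by (simp add: posterior_def)
  next
    case False
    then have "integrable P (lik_ratio f0 n \<omega>)" using not_integrable_integral_eq by blast
    then have "(\<integral>\<^sup>+f. ennreal (lik_ratio f0 n \<omega> f) \<partial>P) = ennreal ?I"
      by (intro nn_integral_eq_integral AE_I2 lik_ratio_nonneg[OF \<omega>])
    with b nn have "b \<le> ?I" by simp
    then show ?thesis
      unfolding posterior_def using L_nonneg[OF \<omega>] \<open>0 < b\<close> by (intro divide_left_mono) auto
  qed
qed

text \<open>
  This is where the assumption on the Hellinger distance enters. Both \<open>\<rho>\<close> and \<open>D\<close> depend on \<open>\<omega>\<close>.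
\<close>
lemma prod_damping_le:
  assumes "0 < liminf (\<lambda>n. ereal (hellinger M (p n \<omega>) f0))"
  shows "\<exists>\<rho> D. 0 < \<rho> \<and> \<rho> < 1 \<and> (\<forall>n. (\<Prod>k<n. damping k \<omega>) \<le> D * \<rho> ^ n)"
proof -
  obtain \<delta> where \<delta>: "0 < \<delta>" "ereal \<delta> < liminf (\<lambda>n. ereal (hellinger M (p n \<omega>) f0))"
    using ereal_dense2[OF assms] by (auto simp: zero_ereal_def)
  then obtain N where N: "\<And>n. N \<le> n \<Longrightarrow> \<delta> < hellinger M (p n \<omega>) f0"
    using less_LiminfD[OF \<delta>(2)] by (auto simp: eventually_sequentially)
  define \<rho> where "\<rho> = max (1 / 2) (1 - \<delta>\<^sup>2 / 2)"
  have \<rho>: "0 < \<rho>" "\<rho> < 1" using \<delta> by (auto simp: \<rho>_def less_max_iff_disj)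
  have damp: "damping n \<omega> \<le> \<rho>" if "N \<le> n" for n
  proof -
    have "\<delta>\<^sup>2 \<le> (hellinger M (p n \<omega>) f0)\<^sup>2" using N[OF that] \<delta> by (intro power_mono) auto
    then show ?thesis by (auto simp: damping_def \<rho>_def max_def)
  qed
  have "(\<Prod>k<n. damping k \<omega>) \<le> (1 / \<rho> ^ N) * \<rho> ^ n" for n
  proof -
    have "(\<Prod>k<n. damping k \<omega>) * \<rho> ^ N \<le> \<rho> ^ n"
    proof (induction n)
      case 0
      show ?case using \<rho> by (simp add: power_le_one)
    next
      case (Suc n)
      show ?case
      proof (cases "N \<le> n")
        case True
        have "((\<Prod>k<n. damping k \<omega>) * \<rho> ^ N) * damping n \<omega> \<le> \<rho> ^ n * \<rho>"
          using Suc damp[OF True] \<rho> damping_pos[of n \<omega>] by (intro mult_mono) (auto simp: less_imp_le)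
        then show ?thesis by (simp add: mult_ac)
      next
        case False
        have "(\<Prod>k<Suc n. damping k \<omega>) * \<rho> ^ N \<le> 1 * \<rho> ^ Suc n"
          using False \<rho> damping_pos damping_le_1
          by (intro mult_mono prod_le_1 power_decreasing) (auto simp: less_imp_le)
        then show ?thesis by simp
      qed
    qed
    then show ?thesis using \<rho> by (simp add: field_simps)
  qed
  with \<rho> show ?thesis by blast
qed

text \<open>
  The rate \<open>\<rho>\<close> of decay of the numerator is random, so the subexponential bounds are needed
  for arbitrarily small exponents on one and the same event of full measure; the reciprocals of the
  positive integers suffice.
\<close>
lemma posterior_tendsto_0:
  assumes kl: "kl_property M P f0"
    and pos: "\<forall>n. AE \<omega> in law. 0 < L n \<omega>"
    and away: "AE \<omega> in law. 0 < liminf (\<lambda>n. ereal (hellinger M (p n \<omega>) f0))"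
  shows "AE \<omega> in law. (\<lambda>n. posterior P f0 n \<omega> A) \<longlonglongrightarrow> 0"
proof -
  have "AE \<omega> in law. \<forall>m. \<exists>C. \<forall>n. damped_root n \<omega> \<le> C * exp (1 / real (Suc m) * real n)"
    unfolding AE_all_countable by (intro allI AE_damped_root_subexponential pos) simp
  moreover have "AE \<omega> in law. \<forall>m. \<exists>c>0. \<forall>n. ennreal (c * exp (- (1 / real (Suc m)) * real n))
      \<le> (\<integral>\<^sup>+f. ennreal (lik_ratio f0 n \<omega> f) \<partial>P)"
    unfolding AE_all_countable by (intro allI AE_evidence_lower_bound kl) simp
  ultimately show ?thesis
    using away AE_space
  proof eventually_elim
    case (elim \<omega>)
    note \<omega> = elim(4)
    obtain \<rho> D where \<rho>: "0 < \<rho>" "\<rho> < 1" and D: "\<And>n. (\<Prod>k<n. damping k \<omega>) \<le> D * \<rho> ^ n"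
      using prod_damping_le[OF elim(3)] by blast
    \<comment> \<open>The exponent \<open>\<eta>\<close> is lost twice in the numerator, because of the square, and once in the
      denominator, against the gain \<open>- 2 * ln \<rho>\<close>.\<close>
    obtain m where m: "1 / real (Suc m) < - 2 * ln \<rho> / 3"
      using reals_Archimedean[of "- 2 * ln \<rho> / 3"] \<rho> by (auto simp: inverse_eq_divide)
    define \<eta> where "\<eta> = 1 / real (Suc m)"
    obtain C where C: "\<And>n. damped_root n \<omega> \<le> C * exp (\<eta> * real n)"
      using elim(1) unfolding \<eta>_def by blast
    obtain c where c: "0 < c" and b: "\<And>n. ennreal (c * exp (- \<eta> * real n))
        \<le> (\<integral>\<^sup>+f. ennreal (lik_ratio f0 n \<omega> f) \<partial>P)"
      using elim(2) unfolding \<eta>_def by blast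
    define r where "r = exp (3 * \<eta> + 2 * ln \<rho>)"
    have r: "0 < r" "r < 1" using m by (auto simp: r_def \<eta>_def field_simps)
    have sqrt_L: "sqrt (L n \<omega>) \<le> C * D * (exp \<eta> * \<rho>) ^ n" for n
    proof -
      have pp: "0 < (\<Prod>k<n. damping k \<omega>)" by (intro prod_pos) (simp add: damping_pos)
      have "sqrt (L n \<omega>) = damped_root n \<omega> * (\<Prod>k<n. damping k \<omega>)"
        using pp by (simp only: damped_root_def nonzero_divide_eq_eq[symmetric])
      also have "\<dots> \<le> (C * exp (\<eta> * real n)) * (D * \<rho> ^ n)"
        using damped_root_nonneg[OF \<omega>, of n] C[of n] D[of n] pp by (intro mult_mono) auto
      also have "\<dots> = C * D * (exp \<eta> * \<rho>) ^ n"
        by (simp add: power_mult_distrib exp_of_nat2_mult mult_ac)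
      finally show ?thesis .
    qed
    have upper: "posterior P f0 n \<omega> A \<le> (C * D)\<^sup>2 / c * r ^ n" for n
    proof -
      have "L n \<omega> = (sqrt (L n \<omega>))\<^sup>2" using L_nonneg[OF \<omega>] by simp
      also have "\<dots> \<le> (C * D * (exp \<eta> * \<rho>) ^ n)\<^sup>2"
        using sqrt_L L_nonneg[OF \<omega>] by (intro power_mono) auto
      also have "\<dots> = (C * D)\<^sup>2 * ((exp \<eta> * \<rho>)\<^sup>2) ^ n"
        by (simp add: power_mult_distrib mult.commute flip: power_mult)
      finally have "L n \<omega> / (c * exp (- \<eta> * real n))
          \<le> (C * D)\<^sup>2 * ((exp \<eta> * \<rho>)\<^sup>2) ^ n / (c * exp (- \<eta> * real n))"
        using c by (intro divide_right_mono) auto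
      also have "\<dots> = (C * D)\<^sup>2 / c * (((exp \<eta> * \<rho>)\<^sup>2) ^ n * exp \<eta> ^ n)"
        by (simp add: exp_minus exp_of_nat2_mult field_simps)
      also have "((exp \<eta> * \<rho>)\<^sup>2) ^ n * exp \<eta> ^ n = r ^ n"
      proof -
        have "r = (exp \<eta>) ^ 3 * \<rho>\<^sup>2"
          using \<rho> exp_of_nat_mult[of 3 \<eta>] exp_of_nat_mult[of 2 "ln \<rho>"]
          by (simp add: r_def exp_add)
        then have "r = (exp \<eta> * \<rho>)\<^sup>2 * exp \<eta>"
          by (simp add: power2_eq_square power3_eq_cube mult_ac)
        then show ?thesis by (simp add: power_mult_distrib)
      qed
      finally show ?thesis
        using posterior_le(2)[OF \<omega> _ b[of n]] c by (auto intro: order_trans)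
    qed
    have "(\<lambda>n. (C * D)\<^sup>2 / c * r ^ n) \<longlonglongrightarrow> 0"
      using r by (intro tendsto_mult_right_zero LIMSEQ_power_zero) auto
    then show ?case
      by (rule tendsto_sandwich[OF _ _ tendsto_const, rotated 2])
        (use posterior_le(1)[OF \<omega> _ b] c upper in auto)
  qed
qed

end

theorem theorem1:
  fixes X :: "'a::euclidean_space set"
    and M :: "'a measure"
    and f0 :: "'a \<Rightarrow> real"
    and P :: "('a \<Rightarrow> real) measure"
    and A :: "('a \<Rightarrow> real) set"
  defines "M \<equiv> restrict_space lborel X"
  assumes "X \<in> sets borel"
    and "f0 \<in> densities M"
    and "is_prior M P"
    and "kl_property M P f0"
    and "A \<in> sets P"
    and "\<forall>n. AE \<omega> in seq_law M f0. restr_lik P f0 A n \<omega> > 0"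
    and "AE \<omega> in seq_law M f0.
           liminf (\<lambda>n. ereal (hellinger M (predictive P f0 A n \<omega>) f0)) > 0"
  shows "AE \<omega> in seq_law M f0. (\<lambda>n. posterior P f0 n \<omega> A) \<longlonglongrightarrow> 0"
proof -
  have "sigma_finite_measure M"
    unfolding M_def using \<open>X \<in> sets borel\<close>
    by (intro sigma_finite_measure_restrict_space lborel.sigma_finite_measure_axioms) simp
  then interpret restricted_bayes_model M f0 P A
    using assms by (intro restricted_bayes_model.intro bayes_model.intro restricted_bayes_model_axioms.intro)
  show ?thesis
    using posterior_tendsto_0 assms(5,7,8) unfolding seq_law_eq by blast
qed

end
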